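(* Let $\mathcal{A}$ and $\mathcal{B}$ be two finite categories. Then $$\chi(\mathcal{A}\sqcup\mathcal{B})=\chi(\mathcal{A})+\chi(\mathcal{B}),$$ where $\mathcal{A}\sqcup\mathcal{B}$ is the disjoint union of $\mathcal{A}$ and $\mathcal{B}$.
   Context: A finite category is a category with finitely many objects and finitely many morphisms. All matrices have entries in $\mathbb{Q}$, and $M^*$ denotes the transpose of $M$. The Moore–Penrose inverse of an $m\times n$-matrix $M$ is the unique $n\times m$-matrix $M^+$ satisfying $MM^+M=M$, $M^+MM^+=M^+$, $(M^+M)^*=M^+M$, $(MM^+)^*=MM^+$. $\mathbf{1}_m$ denotes the $m\times 1$-matrix all of whose entries are $1$. For a finite category $\mathcal{A}$ with object set $\{a_1,\dots,a_m\}$, $|\mathcal{A}|=m$ is the number of objects and $[\mathcal{A}]$ is the $m\times m$-matrix whose $ij$-th entry is the number of elements of the morphism set $\mathcal{A}(a_i,a_j)$. Define $\chi(\mathcal{A})=\mathbf{1}_{|\mathcal{A}|}^*[\mathcal{A}]^+\mathbf{1}_{|\mathcal{A}|}$, a $1\times 1$-matrix regarded as a rational number (it does not depend on the chosen order of the objects). *)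

theory Defs
  imports "Jordan_Normal_Form.Matrix"
begin

record ('o, 'm) category =
  Obj :: "'o set"
  Arr :: "'m set"
  Dom :: "'m \<Rightarrow> 'o"
  Cod :: "'m \<Rightarrow> 'o"
  Ident :: "'o \<Rightarrow> 'm"
  Comp :: "'m \<Rightarrow> 'm \<Rightarrow> 'm"

definition hom_set :: "('o, 'm) category \<Rightarrow> 'o \<Rightarrow> 'o \<Rightarrow> 'm set" where
  "hom_set C a b = {f \<in> Arr C. Dom C f = a \<and> Cod C f = b}"

text \<open>\<open>Comp C g f\<close> is the composite "g after f". The operations \<open>Dom\<close>, \<open>Cod\<close>, \<open>Ident\<close>
  and \<open>Comp\<close> are unconstrained outside the arrows, the objects and the composable pairs.\<close>

definition is_category :: "('o, 'm) category \<Rightarrow> bool" where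
  "is_category C \<longleftrightarrow>
     (\<forall>f\<in>Arr C. Dom C f \<in> Obj C \<and> Cod C f \<in> Obj C) \<and>
     (\<forall>a\<in>Obj C. Ident C a \<in> hom_set C a a) \<and>
     (\<forall>a\<in>Obj C. \<forall>b\<in>Obj C. \<forall>c\<in>Obj C. \<forall>f\<in>hom_set C a b. \<forall>g\<in>hom_set C b c.
        Comp C g f \<in> hom_set C a c) \<and>
     (\<forall>a\<in>Obj C. \<forall>b\<in>Obj C. \<forall>f\<in>hom_set C a b.
        Comp C f (Ident C a) = f \<and> Comp C (Ident C b) f = f) \<and>
     (\<forall>a\<in>Obj C. \<forall>b\<in>Obj C. \<forall>c\<in>Obj C. \<forall>d\<in>Obj C.
        \<forall>f\<in>hom_set C a b. \<forall>g\<in>hom_set C b c. \<forall>h\<in>hom_set C c d.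
          Comp C h (Comp C g f) = Comp C (Comp C h g) f)"

definition finite_category :: "('o, 'm) category \<Rightarrow> bool" where
  "finite_category C \<longleftrightarrow> is_category C \<and> finite (Obj C) \<and> finite (Arr C)"

text \<open>Two arrows from different summands are never composable, so the last branch of the
  composition is irrelevant.\<close>

definition disjoint_union ::
  "('o, 'm) category \<Rightarrow> ('p, 'n) category \<Rightarrow> ('o + 'p, 'm + 'n) category" where
  "disjoint_union A B =
     \<lparr> Obj = Obj A <+> Obj B,
       Arr = Arr A <+> Arr B,
       Dom = map_sum (Dom A) (Dom B),
       Cod = map_sum (Cod A) (Cod B),
       Ident = map_sum (Ident A) (Ident B),
       Comp = (\<lambda>g f. case (g, f) of
                  (Inl g', Inl f') \<Rightarrow> Inl (Comp A g' f')
                | (Inr g', Inr f') \<Rightarrow> Inr (Comp B g' f')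
                | _ \<Rightarrow> undefined) \<rparr>"

lemma hom_set_disjoint_union [simp]:
  "hom_set (disjoint_union A B) (Inl a) (Inl a') = Inl ` hom_set A a a'"
  "hom_set (disjoint_union A B) (Inr b) (Inr b') = Inr ` hom_set B b b'"
  "hom_set (disjoint_union A B) (Inl a) (Inr b) = {}"
  "hom_set (disjoint_union A B) (Inr b) (Inl a) = {}"
  by (auto simp: hom_set_def disjoint_union_def)

lemma is_category_disjoint_union:
  assumes A: "is_category A" and B: "is_category B"
  shows "is_category (disjoint_union A B)"
proof -
  have [simp]: "Obj (disjoint_union A B) = Obj A <+> Obj B"
    "Ident (disjoint_union A B) (Inl a) = Inl (Ident A a)"
    "Ident (disjoint_union A B) (Inr b) = Inr (Ident B b)"
    "Comp (disjoint_union A B) (Inl g) (Inl f) = Inl (Comp A g f)"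
    "Comp (disjoint_union A B) (Inr k) (Inr h) = Inr (Comp B k h)" for a b f g h k
    by (simp_all add: disjoint_union_def)
  have "\<forall>f\<in>Arr (disjoint_union A B).
      Dom (disjoint_union A B) f \<in> Obj A <+> Obj B \<and> Cod (disjoint_union A B) f \<in> Obj A <+> Obj B"
    using A B by (auto simp: is_category_def disjoint_union_def)
  then show ?thesis
    using A B unfolding is_category_def by (simp add: Plus_def ball_Un)
qed

lemma finite_category_disjoint_union:
  "finite_category A \<Longrightarrow> finite_category B \<Longrightarrow> finite_category (disjoint_union A B)"
  by (auto simp: finite_category_def is_category_disjoint_union)
     (auto simp: disjoint_union_def)

definition is_pseudoinverse :: "rat mat \<Rightarrow> rat mat \<Rightarrow> bool" where
  "is_pseudoinverse M N \<longleftrightarrow>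
     N \<in> carrier_mat (dim_col M) (dim_row M) \<and>
     M * N * M = M \<and>
     N * M * N = N \<and>
     transpose_mat (N * M) = N * M \<and>
     transpose_mat (M * N) = M * N"

definition pseudoinverse :: "rat mat \<Rightarrow> rat mat" where
  "pseudoinverse M = (THE N. is_pseudoinverse M N)"

definition ones_mat :: "nat \<Rightarrow> rat mat" where
  "ones_mat m = mat m 1 (\<lambda>_. 1)"

definition ordering_of :: "('o, 'm) category \<Rightarrow> 'o list \<Rightarrow> bool" where
  "ordering_of C as \<longleftrightarrow> distinct as \<and> set as = Obj C"

definition cat_mat :: "('o, 'm) category \<Rightarrow> 'o list \<Rightarrow> rat mat" where
  "cat_mat C as =
     mat (length as) (length as) (\<lambda>(i, j). of_nat (card (hom_set C (as ! i) (as ! j))))"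

definition euler_char_wrt :: "('o, 'm) category \<Rightarrow> 'o list \<Rightarrow> rat" where
  "euler_char_wrt C as =
     (transpose_mat (ones_mat (length as)) * pseudoinverse (cat_mat C as)
        * ones_mat (length as)) $$ (0, 0)"

text \<open>The value of \<open>euler_char_wrt C as\<close> is the same for every ordering \<open>as\<close> of the objects: reordering
  conjugates the matrix by a permutation matrix, and pseudoinversion commutes with that. So an
  arbitrary ordering may be chosen.\<close>

definition euler_char :: "('o, 'm) category \<Rightarrow> rat" where
  "euler_char C = euler_char_wrt C (SOME as. ordering_of C as)"

end

theory Submission
  imports Defs "Jordan_Normal_Form.Gauss_Jordan_Elimination" "HOL-Combinatorics.Permutations"
begin

text \<open>
  The Euler characteristic of a finite category is the sum of the entries of the Moore--Penrose
  inverse of its matrix of hom-set cardinalities. If the objects of \<open>A\<close> are listed before those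
  of \<open>B\<close>, the matrix of the disjoint union is block diagonal, because no arrow joins the two
  summands (\<open>cat_mat_disjoint_union\<close>). The block-diagonal matrix built from the pseudoinverses of
  the two blocks satisfies the four Penrose equations, since products and transposes are formed
  blockwise (\<open>pseudoinverse_block_diag\<close>); and the entries of a block-diagonal matrix sum to the
  total over its blocks.

  Two facts make this argument meaningful. First, \<open>pseudoinverse M\<close> is a definite description, so
  every rational matrix must be shown to have exactly one pseudoinverse. Existence follows
  Urquhart's formula: an inner inverse \<open>H\<close> of the Gram matrix \<open>M\<^sup>T M\<close>, found by row reduction,
  gives \<open>L = H M\<^sup>T\<close> with \<open>M L M = M\<close> and \<open>M L\<close> symmetric; transposing, there is
  \<open>K\<close> with \<open>M K M = M\<close> and \<open>K M\<close> symmetric; and \<open>K M L\<close> satisfies all four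
  equations. Second, \<open>euler_char\<close> uses an arbitrarily chosen ordering of the objects, which for the
  disjoint union need not list the two summands one after the other. Hence
  \<open>euler_char_wrt_independent\<close>: reordering the objects permutes rows and columns simultaneously,
  and this commutes with pseudoinversion and preserves the sum of the entries.
\<close>

section \<open>Existence and uniqueness of the Moore--Penrose inverse\<close>

text \<open>
  The associativity law with carrier premises makes the simplifier guess intermediate dimensions.
  In \<open>mat_mult_assoc\<close> and \<open>mat_transpose_mult\<close> below, the side conditions are equations between
  dimensions, which simplification settles directly.
\<close>
declare assoc_mult_mat [simp del]

lemma mat_mult_assoc:
  fixes A :: "'a :: semiring_0 mat"
  assumes "dim_col A = dim_row B" and "dim_col B = dim_row C"
  shows "A * B * C = A * (B * C)"
  by (rule assoc_mult_mat[of A "dim_row A" "dim_col A" B "dim_col B" C "dim_col C"])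
    (use assms in auto)

lemma mat_transpose_mult:
  fixes A :: "'a :: comm_semiring_0 mat"
  assumes "dim_col A = dim_row B"
  shows "transpose_mat (A * B) = transpose_mat B * transpose_mat A"
  by (rule transpose_mult[of A "dim_row A" "dim_col A" B "dim_col B"])
    (use assms in auto)

text \<open>
  In reduced row echelon form the pivot columns are distinct unit vectors. The matrix \<open>X\<close> that
  selects the pivot columns therefore makes \<open>C * X\<close> the diagonal projection onto the nonzero rows,
  which leaves \<open>C\<close> unchanged.
\<close>
lemma row_echelon_form_inner_inverse:
  fixes C :: "'a :: field mat"
  assumes C: "C \<in> carrier_mat nr nc" and "row_echelon_form C"
  shows "\<exists>X \<in> carrier_mat nc nr. C * X * C = C"
proof -
  have dims: "dim_row C = nr" "dim_col C = nc"
    using C by auto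
  obtain f where f: "pivot_fun C f nc"
    using assms by (auto simp: row_echelon_form_def)
  note piv = pivot_funD[OF dims(1) f]
  \<comment> \<open>A zero row \<open>i\<close> has \<open>f i = nc\<close>, so its column in \<open>X\<close> vanishes.\<close>
  define X where "X = mat nc nr (\<lambda>(j, i). if j = f i then 1 else 0 :: 'a)"
  have X: "X \<in> carrier_mat nc nr"
    by (simp add: X_def)
  have CX: "(C * X) $$ (i', i) = (if i' = i \<and> f i < nc then 1 else 0)"
    if "i' < nr" "i < nr" for i' i
  proof -
    have "(C * X) $$ (i', i) = (\<Sum>k<nc. C $$ (i', k) * (if k = f i then 1 else 0))"
      using that dims by (simp add: X_def scalar_prod_def lessThan_atLeast0)
    also have "\<dots> = (if f i < nc then C $$ (i', f i) else 0)"
      by (simp add: sum.delta if_distrib cong: if_cong)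
    finally show ?thesis
      using piv(4)[OF that(2)] piv(5)[OF that(2) _ that(1)] by auto
  qed
  have "C * X * C = C"
  proof (rule eq_matI)
    fix i j assume "i < dim_row C" "j < dim_col C"
    then have i: "i < nr" and j: "j < nc"
      using dims by auto
    have "(C * X * C) $$ (i, j) = (\<Sum>k<nr. (C * X) $$ (i, k) * C $$ (k, j))"
      using i j dims X by (simp add: scalar_prod_def lessThan_atLeast0 del: index_mult_mat(1))
         (simp add: scalar_prod_def)
    also have "\<dots> = (\<Sum>k<nr. if k = i then (if f i < nc then C $$ (i, j) else 0) else 0)"
      by (rule sum.cong) (use CX[OF i] in auto)
    also have "\<dots> = C $$ (i, j)"
      using i piv(1)[OF i] piv(2)[OF i, of j] j by auto
    finally show "(C * X * C) $$ (i, j) = C $$ (i, j)" .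
  qed (use X dims in auto)
  with X show ?thesis by blast
qed

text \<open>
  If \<open>P * M\<close> is the reduced row echelon form, with \<open>P\<close> invertible, and \<open>X\<close> is an inner inverse of
  it, then cancelling \<open>P\<close> in \<open>P M X P M = P M\<close> shows that \<open>X * P\<close> is an inner inverse of \<open>M\<close>.
\<close>
lemma inner_inverse_exists:
  fixes M :: "'a :: field mat"
  assumes M: "M \<in> carrier_mat nr nc"
  shows "\<exists>X \<in> carrier_mat nc nr. M * X * M = M"
proof -
  define C where "C = gauss_jordan_single M"
  have C: "C \<in> carrier_mat nr nc" "row_echelon_form C"
    using gauss_jordan_single[OF M] C_def by auto
  obtain P Q where P: "P \<in> carrier_mat nr nr" and Q: "Q \<in> carrier_mat nr nr"
    and CP: "C = P * M" and QP: "Q * P = 1\<^sub>m nr"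
    using gauss_jordan_single(4)[OF M, of C] C_def by auto
  obtain X where X: "X \<in> carrier_mat nc nr" and CXC: "C * X * C = C"
    using row_echelon_form_inner_inverse[OF C] by blast
  have cancel: "Q * (P * B) = B" if "B \<in> carrier_mat nr k" for B k
    using mat_mult_assoc[of Q P B] that P Q QP left_mult_one_mat[OF that] by auto
  have "M * (X * P) * M = Q * (P * (M * (X * P) * M))"
    by (rule cancel[symmetric, where k = nc]) (use M X P in auto)
  also have "\<dots> = Q * (C * X * C)"
    using carrier_matD[OF M] carrier_matD[OF X] carrier_matD[OF P]
    by (simp add: CP mat_mult_assoc)
  also have "\<dots> = M"
    using cancel[OF M] CXC CP by simp
  finally show ?thesis
    using X P by (intro bexI[of _ "X * P"]) auto
qed

text \<open>
  The diagonal entries of \<open>D\<^sup>T D\<close> are the sums of squares of the columns of \<open>D\<close>. This is where the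
  ordering of the scalars enters.
\<close>
lemma transpose_mult_self_eq_0:
  fixes D :: "'a :: linordered_idom mat"
  assumes "transpose_mat D * D = 0\<^sub>m n m"
  shows "D = 0\<^sub>m (dim_row D) (dim_col D)"
proof (rule eq_matI)
  fix i j
  assume "i < dim_row (0\<^sub>m (dim_row D) (dim_col D) :: 'a mat)"
    and "j < dim_col (0\<^sub>m (dim_row D) (dim_col D) :: 'a mat)"
  then have i: "i < dim_row D" and j: "j < dim_col D"
    by auto
  have "n = dim_col D" "m = dim_col D"
    using arg_cong[OF assms, of dim_row] arg_cong[OF assms, of dim_col] by auto
  then have "(transpose_mat D * D) $$ (j, j) = 0"
    using j by (simp add: assms)
  then have "(\<Sum>k<dim_row D. D $$ (k, j) * D $$ (k, j)) = 0"
    using j by (simp add: scalar_prod_def lessThan_atLeast0)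
  then have "D $$ (i, j) * D $$ (i, j) = 0"
    by (subst (asm) sum_nonneg_eq_0_iff) (use i in auto)
  then show "D $$ (i, j) = 0\<^sub>m (dim_row D) (dim_col D) $$ (i, j)"
    using i j by simp
qed auto

text \<open>
  The difference \<open>D = M (X - Y)\<close> satisfies \<open>D\<^sup>T D = (X - Y)\<^sup>T M\<^sup>T D = 0\<close>.
\<close>
lemma gram_mult_cancel:
  fixes M :: "'a :: linordered_idom mat"
  assumes M: "M \<in> carrier_mat nr nc" and X: "X \<in> carrier_mat nc k" and Y: "Y \<in> carrier_mat nc k"
    and eq: "transpose_mat M * (M * X) = transpose_mat M * (M * Y)"
  shows "M * X = M * Y"
proof -
  define D where "D = M * (X - Y)"
  have D: "D \<in> carrier_mat nr k"
    using M Y by (auto simp: D_def)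
  have DXY: "D = M * X - M * Y"
    using mult_minus_distrib_mat[OF M X Y] by (simp add: D_def)
  have "transpose_mat M * D = transpose_mat M * (M * X) - transpose_mat M * (M * Y)"
    unfolding DXY
    by (rule mult_minus_distrib_mat[of _ nc nr]) (use M X Y in auto)
  also have "\<dots> = 0\<^sub>m nc k"
    unfolding eq using M Y by auto
  finally have MD: "transpose_mat M * D = 0\<^sub>m nc k" .
  have "transpose_mat D * D = transpose_mat (X - Y) * (transpose_mat M * D)"
    using carrier_matD[OF M] carrier_matD[OF X] carrier_matD[OF Y]
    by (simp add: D_def mat_transpose_mult mat_mult_assoc)
  also have "\<dots> = 0\<^sub>m k k"
    unfolding MD using X Y by simp
  finally have D0: "D = 0\<^sub>m nr k"
    using transpose_mult_self_eq_0[of D k k] D by auto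
  show ?thesis
  proof (rule eq_matI)
    fix i j assume "i < dim_row (M * Y)" "j < dim_col (M * Y)"
    then have ij: "i < nr" "j < k" using M Y by auto
    have "(M * X - M * Y) $$ (i, j) = 0"
      using D0 DXY ij by simp
    then show "(M * X) $$ (i, j) = (M * Y) $$ (i, j)"
      using ij M X Y by (simp del: index_mult_mat(1) add: index_mult_mat(2,3))
  qed (use M X Y in auto)
qed

text \<open>
  Take \<open>L = H M\<^sup>T\<close> for an inner inverse \<open>H\<close> of \<open>M\<^sup>T M\<close>. Cancelling \<open>M\<^sup>T\<close> in
  \<open>M\<^sup>T M H M\<^sup>T M = M\<^sup>T M\<close> gives \<open>M L M = M\<close>. The product \<open>M L\<close> is symmetric because
  \<open>(M L)\<^sup>T = M H\<^sup>T M\<^sup>T\<close> is fixed under left multiplication by \<open>M L\<close>, so that it equals the symmetric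
  matrix \<open>M L (M L)\<^sup>T\<close>.
\<close>
lemma least_squares_inverse_exists:
  fixes M :: "'a :: linordered_field mat"
  assumes M: "M \<in> carrier_mat nr nc"
  shows "\<exists>L \<in> carrier_mat nc nr. M * L * M = M \<and> transpose_mat (M * L) = M * L"
proof -
  let ?T = "transpose_mat M"
  have TM: "?T * M \<in> carrier_mat nc nc"
    using M by auto
  obtain H where H: "H \<in> carrier_mat nc nc" and GHG: "?T * M * H * (?T * M) = ?T * M"
    using inner_inverse_exists[OF TM] by auto
  define L where "L = H * ?T"
  have L: "L \<in> carrier_mat nc nr"
    using M H by (auto simp: L_def)
  have "M * (L * M) = M * 1\<^sub>m nc"
    by (rule gram_mult_cancel[OF M, where k = nc])
      (use M H carrier_matD[OF M] carrier_matD[OF H] GHG in \<open>auto simp: L_def mat_mult_assoc\<close>)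
  then have inner_L: "M * L * M = M"
    using carrier_matD[OF M] carrier_matD[OF L] right_mult_one_mat[OF M]
    by (simp add: mat_mult_assoc)
  have "M * L * transpose_mat (M * L) = M * L * M * (transpose_mat H * ?T)"
    using carrier_matD[OF M] carrier_matD[OF H]
    by (simp add: L_def mat_transpose_mult mat_mult_assoc)
  also have "\<dots> = transpose_mat (M * L)"
    unfolding inner_L using carrier_matD[OF M] carrier_matD[OF H]
    by (simp add: L_def mat_transpose_mult mat_mult_assoc)
  finally have proj: "M * L * transpose_mat (M * L) = transpose_mat (M * L)" .
  have "M * L = transpose_mat (M * L * transpose_mat (M * L))"
    unfolding proj by simp
  also have "\<dots> = M * L * transpose_mat (M * L)"
    using M L by (subst mat_transpose_mult) auto
  finally have "transpose_mat (M * L) = M * L"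
    unfolding proj by simp
  with L inner_L show ?thesis by blast
qed

text \<open>
  Urquhart's formula \<open>N = K M L\<close>: the choice of \<open>L\<close> makes \<open>M N = M L\<close> symmetric and the choice
  of \<open>K\<close> makes \<open>N M = K M\<close> symmetric.
\<close>
lemma is_pseudoinverse_exists: "\<exists>N. is_pseudoinverse M N"
proof -
  let ?r = "dim_row M" and ?c = "dim_col M"
  have M: "M \<in> carrier_mat ?r ?c" by auto
  obtain L where L: "L \<in> carrier_mat ?c ?r"
    and inner_L: "M * L * M = M" and sym_L: "transpose_mat (M * L) = M * L"
    using least_squares_inverse_exists[OF M] by blast
  \<comment> \<open>The left-handed analogue of \<open>L\<close> comes from the transposed matrix.\<close>
  have "transpose_mat M \<in> carrier_mat ?c ?r" by auto
  then obtain K' where K': "K' \<in> carrier_mat ?r ?c"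
    and K'1: "transpose_mat M * K' * transpose_mat M = transpose_mat M"
    and K'2: "transpose_mat (transpose_mat M * K') = transpose_mat M * K'"
    using least_squares_inverse_exists by blast
  define K where "K = transpose_mat K'"
  have K: "K \<in> carrier_mat ?c ?r"
    using K' by (simp add: K_def)
  note dims = carrier_matD[OF L] carrier_matD[OF K'] carrier_matD[OF K]
  have MKM: "M * K * M = M"
    using arg_cong[OF K'1, of transpose_mat] dims
    by (simp add: K_def mat_transpose_mult mat_mult_assoc)
  have KM: "transpose_mat (K * M) = K * M"
    using K'2 dims by (simp add: K_def mat_transpose_mult)
  define N where "N = K * M * L"
  have N: "N \<in> carrier_mat ?c ?r"
    using K L by (auto simp: N_def)
  have "M * N = M * K * M * L"
    using dims by (simp add: N_def mat_mult_assoc)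
  then have MN: "M * N = M * L"
    by (simp only: MKM)
  have "N * M = K * (M * L * M)"
    using dims by (simp add: N_def mat_mult_assoc)
  then have NM: "N * M = K * M"
    by (simp only: inner_L)
  have "N * M * N = K * (M * K * M) * L"
    unfolding NM using dims by (simp add: N_def mat_mult_assoc)
  then have "N * M * N = N"
    unfolding MKM N_def .
  then have "is_pseudoinverse M N"
    unfolding is_pseudoinverse_def using N by (auto simp: MN NM inner_L sym_L KM)
  then show ?thesis ..
qed

text \<open>
  Both \<open>N M\<close> and \<open>L M\<close> are symmetric with \<open>(N M)(L M) = N M\<close>; transposing this gives
  \<open>(L M)(N M) = N M\<close>, while the left side is also \<open>L M\<close>. So \<open>N M = L M\<close>, and likewise
  \<open>M N = M L\<close>. Hence \<open>N = N M N = L M N = L M L = L\<close>.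
\<close>
lemma is_pseudoinverse_unique:
  assumes "is_pseudoinverse M N" and "is_pseudoinverse M L"
  shows "N = L"
proof -
  have N: "N \<in> carrier_mat (dim_col M) (dim_row M)" "M * N * M = M" "N * M * N = N"
      "transpose_mat (N * M) = N * M" "transpose_mat (M * N) = M * N"
    and L: "L \<in> carrier_mat (dim_col M) (dim_row M)" "M * L * M = M" "L * M * L = L"
      "transpose_mat (L * M) = L * M" "transpose_mat (M * L) = M * L"
    using assms by (auto simp: is_pseudoinverse_def)
  have d: "dim_row N = dim_col M" "dim_col N = dim_row M"
      "dim_row L = dim_col M" "dim_col L = dim_row M"
    using N(1) L(1) by auto
  have "N * M = transpose_mat (N * (M * L * M))"
    by (simp only: L(2) N(4))
  also have "\<dots> = transpose_mat ((N * M) * (L * M))"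
    by (simp add: mat_mult_assoc d)
  also have "\<dots> = (L * M) * (N * M)"
    by (subst mat_transpose_mult) (simp_all only: N(4) L(4) d index_mult_mat)
  also have "\<dots> = L * (M * N * M)"
    by (simp add: mat_mult_assoc d)
  finally have NM: "N * M = L * M"
    by (simp only: N(2))
  have "M * N = transpose_mat ((M * L * M) * N)"
    by (simp only: L(2) N(5))
  also have "\<dots> = transpose_mat ((M * L) * (M * N))"
    by (simp add: mat_mult_assoc d)
  also have "\<dots> = (M * N) * (M * L)"
    by (subst mat_transpose_mult) (simp_all only: N(5) L(5) d index_mult_mat)
  also have "\<dots> = (M * N * M) * L"
    by (simp add: mat_mult_assoc d)
  finally have MN: "M * N = M * L"
    by (simp only: N(2))
  have "N = N * M * N" by (simp only: N(3))
  also have "\<dots> = L * (M * N)" unfolding NM by (simp add: mat_mult_assoc d)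
  also have "\<dots> = L * M * L" unfolding MN by (simp add: mat_mult_assoc d)
  finally show ?thesis by (simp only: L(3))
qed

lemma pseudoinverse_eqI: "is_pseudoinverse M N \<Longrightarrow> pseudoinverse M = N"
  unfolding pseudoinverse_def by (rule the_equality) (auto intro: is_pseudoinverse_unique)

lemma is_pseudoinverse_pseudoinverse: "is_pseudoinverse M (pseudoinverse M)"
  using is_pseudoinverse_exists pseudoinverse_eqI by metis

lemma pseudoinverse_carrier: "M \<in> carrier_mat nr nc \<Longrightarrow> pseudoinverse M \<in> carrier_mat nc nr"
  using is_pseudoinverse_pseudoinverse[of M] by (auto simp: is_pseudoinverse_def)

section \<open>Block-diagonal matrices\<close>

definition block_diag :: "'a :: zero mat \<Rightarrow> 'a mat \<Rightarrow> 'a mat" where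
  "block_diag A D =
     four_block_mat A (0\<^sub>m (dim_row A) (dim_col D)) (0\<^sub>m (dim_row D) (dim_col A)) D"

lemma dim_block_diag [simp]:
  "dim_row (block_diag A D) = dim_row A + dim_row D"
  "dim_col (block_diag A D) = dim_col A + dim_col D"
  by (simp_all add: block_diag_def)

lemma mult_block_diag:
  fixes A :: "'a :: semiring_0 mat"
  assumes "dim_col A = dim_row A'" and "dim_col D = dim_row D'"
  shows "block_diag A D * block_diag A' D' = block_diag (A * A') (D * D')"
proof -
  let ?nr = "dim_row A" and ?mr = "dim_row D" and ?n = "dim_row A'" and ?m = "dim_row D'"
    and ?nc = "dim_col A'" and ?mc = "dim_col D'"
  have A: "A \<in> carrier_mat ?nr ?n" "A' \<in> carrier_mat ?n ?nc"
    and D: "D \<in> carrier_mat ?mr ?m" "D' \<in> carrier_mat ?m ?mc"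
    using assms by auto
  have AA: "A * A' \<in> carrier_mat ?nr ?nc" and DD: "D * D' \<in> carrier_mat ?mr ?mc"
    by auto
  have "block_diag A D * block_diag A' D'
      = four_block_mat (A * A' + 0\<^sub>m ?nr ?m * 0\<^sub>m ?m ?nc) (A * 0\<^sub>m ?n ?mc + 0\<^sub>m ?nr ?m * D')
          (0\<^sub>m ?mr ?n * A' + D * 0\<^sub>m ?m ?nc) (0\<^sub>m ?mr ?n * 0\<^sub>m ?n ?mc + D * D')"
    unfolding block_diag_def assms
    by (rule mult_four_block_mat[OF A(1) zero_carrier_mat zero_carrier_mat D(1)
          A(2) zero_carrier_mat zero_carrier_mat D(2)])
  also have "\<dots> = block_diag (A * A') (D * D')"
    by (simp only: left_mult_zero_mat[OF A(2)] right_mult_zero_mat[OF A(1)]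
        left_mult_zero_mat[OF D(2)] right_mult_zero_mat[OF D(1)]
        left_mult_zero_mat[OF zero_carrier_mat]
        right_add_zero_mat[OF AA] left_add_zero_mat[OF DD]
        left_add_zero_mat[OF zero_carrier_mat] block_diag_def index_mult_mat)
  finally show ?thesis .
qed

lemma transpose_block_diag:
  "transpose_mat (block_diag A D) = block_diag (transpose_mat A) (transpose_mat D)"
  by (rule eq_matI) (auto simp: block_diag_def)

lemma pseudoinverse_block_diag:
  "pseudoinverse (block_diag A D) = block_diag (pseudoinverse A) (pseudoinverse D)"
proof (rule pseudoinverse_eqI)
  have dims: "dim_row (pseudoinverse M) = dim_col M" "dim_col (pseudoinverse M) = dim_row M" for M
    using pseudoinverse_carrier[of M "dim_row M" "dim_col M"] by auto
  show "is_pseudoinverse (block_diag A D) (block_diag (pseudoinverse A) (pseudoinverse D))"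
    using is_pseudoinverse_pseudoinverse[of A] is_pseudoinverse_pseudoinverse[of D]
    by (auto simp: is_pseudoinverse_def mult_block_diag transpose_block_diag dims)
qed

section \<open>The sum of the entries of the pseudoinverse\<close>

definition sum_entries :: "rat mat \<Rightarrow> rat" where
  "sum_entries N = (\<Sum>i<dim_row N. \<Sum>j<dim_col N. N $$ (i, j))"

lemma sum_entries_block_diag: "sum_entries (block_diag A D) = sum_entries A + sum_entries D"
proof -
  have split: "(\<Sum>i<m + n. g i) = (\<Sum>i<m. g i) + (\<Sum>i<n. g (m + i))" for g :: "nat \<Rightarrow> rat" and m n
    by (induction n) (simp_all add: add.assoc)
  show ?thesis
    by (simp add: sum_entries_def split) (simp add: block_diag_def)
qed

lemma cat_mat_carrier: "cat_mat C as \<in> carrier_mat (length as) (length as)"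
  by (simp add: cat_mat_def)

lemma euler_char_wrt_eq_sum_entries:
  "euler_char_wrt C as = sum_entries (pseudoinverse (cat_mat C as))"
proof -
  define n where "n = length as"
  define N where "N = pseudoinverse (cat_mat C as)"
  have N: "dim_row N = n" "dim_col N = n"
    using pseudoinverse_carrier[OF cat_mat_carrier, of C as] by (auto simp: N_def n_def)
  have "(transpose_mat (ones_mat n) * N * ones_mat n) $$ (0, 0) = (\<Sum>j<n. \<Sum>i<n. N $$ (i, j))"
    using N by (simp add: ones_mat_def scalar_prod_def lessThan_atLeast0)
  also have "\<dots> = sum_entries N"
    unfolding sum_entries_def N by (rule sum.swap)
  finally show ?thesis
    by (simp add: euler_char_wrt_def N_def n_def)
qed

section \<open>Independence of the ordering of the objects\<close>

definition reindex_mat :: "nat \<Rightarrow> (nat \<Rightarrow> nat) \<Rightarrow> 'a mat \<Rightarrow> 'a mat" where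
  "reindex_mat n p M = mat n n (\<lambda>(i, j). M $$ (p i, p j))"

lemma transpose_reindex_mat:
  assumes "p permutes {..<n}" and "M \<in> carrier_mat n n"
  shows "transpose_mat (reindex_mat n p M) = reindex_mat n p (transpose_mat M)"
  using carrier_matD[OF assms(2)] permutes_in_image[OF assms(1)]
  by (intro eq_matI) (auto simp: reindex_mat_def)

lemma mult_reindex_mat:
  fixes M N :: "'a :: semiring_0 mat"
  assumes p: "p permutes {..<n}" and M: "M \<in> carrier_mat n n" and N: "N \<in> carrier_mat n n"
  shows "reindex_mat n p M * reindex_mat n p N = reindex_mat n p (M * N)"
proof (rule eq_matI)
  fix i j
  assume "i < dim_row (reindex_mat n p (M * N))" "j < dim_col (reindex_mat n p (M * N))"
  then have ij: "i < n" "j < n"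
    by (auto simp: reindex_mat_def)
  then have pij: "p i < n" "p j < n"
    using permutes_in_image[OF p] by auto
  have "(reindex_mat n p M * reindex_mat n p N) $$ (i, j)
      = (\<Sum>k<n. M $$ (p i, p k) * N $$ (p k, p j))"
    using ij by (simp add: reindex_mat_def scalar_prod_def lessThan_atLeast0)
  also have "\<dots> = (\<Sum>k<n. M $$ (p i, k) * N $$ (k, p j))"
    by (rule sum.reindex_bij_betw[OF permutes_imp_bij[OF p]])
  also have "\<dots> = reindex_mat n p (M * N) $$ (i, j)"
    using ij pij carrier_matD[OF M] carrier_matD[OF N]
    by (simp add: reindex_mat_def scalar_prod_def lessThan_atLeast0)
  finally show "(reindex_mat n p M * reindex_mat n p N) $$ (i, j)
      = reindex_mat n p (M * N) $$ (i, j)" .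
qed (auto simp: reindex_mat_def)

lemma pseudoinverse_reindex_mat:
  assumes p: "p permutes {..<n}" and M: "M \<in> carrier_mat n n"
  shows "pseudoinverse (reindex_mat n p M) = reindex_mat n p (pseudoinverse M)"
proof (rule pseudoinverse_eqI)
  define N where "N = pseudoinverse M"
  have N: "N \<in> carrier_mat n n"
    using pseudoinverse_carrier[OF M] by (simp add: N_def)
  have "is_pseudoinverse M N"
    by (simp add: N_def is_pseudoinverse_pseudoinverse)
  then have mp: "M * N * M = M" "N * M * N = N"
      "transpose_mat (N * M) = N * M" "transpose_mat (M * N) = M * N"
    by (auto simp: is_pseudoinverse_def)
  have MN: "M * N \<in> carrier_mat n n" "N * M \<in> carrier_mat n n"
    using M N by auto
  have "is_pseudoinverse (reindex_mat n p M) (reindex_mat n p N)"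
    unfolding is_pseudoinverse_def mult_reindex_mat[OF p M N] mult_reindex_mat[OF p N M]
      mult_reindex_mat[OF p MN(1) M] mult_reindex_mat[OF p MN(2) N]
      transpose_reindex_mat[OF p MN(1)] transpose_reindex_mat[OF p MN(2)] mp
    by (simp add: reindex_mat_def)
  then show "is_pseudoinverse (reindex_mat n p M) (reindex_mat n p (pseudoinverse M))"
    by (simp add: N_def)
qed

lemma sum_entries_reindex_mat:
  assumes p: "p permutes {..<n}" and N: "N \<in> carrier_mat n n"
  shows "sum_entries (reindex_mat n p N) = sum_entries N"
proof -
  note bij = permutes_imp_bij[OF p]
  have "sum_entries (reindex_mat n p N) = (\<Sum>i<n. \<Sum>j<n. N $$ (p i, p j))"
    by (simp add: sum_entries_def reindex_mat_def)
  also have "\<dots> = (\<Sum>i<n. \<Sum>j<n. N $$ (p i, j))"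
    by (intro sum.cong refl sum.reindex_bij_betw[OF bij])
  also have "\<dots> = (\<Sum>i<n. \<Sum>j<n. N $$ (i, j))"
    by (rule sum.reindex_bij_betw[OF bij])
  finally show ?thesis
    using carrier_matD[OF N] by (simp add: sum_entries_def)
qed

text \<open>
  Two orderings of the objects differ by a permutation of positions, which permutes the rows and
  the columns of the matrix in the same way.
\<close>
lemma euler_char_wrt_independent:
  assumes as: "ordering_of C as" and bs: "ordering_of C bs"
  shows "euler_char_wrt C as = euler_char_wrt C bs"
proof -
  have "mset as = mset bs"
    using as bs by (simp add: ordering_of_def set_eq_iff_mset_eq_distinct[symmetric])
  then obtain p where p: "p permutes {..<length bs}" and perm: "permute_list p bs = as"
    by (rule mset_eq_permutation)
  have len: "length as = length bs"
    using perm by auto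
  have "cat_mat C as = reindex_mat (length bs) p (cat_mat C bs)"
    using permutes_in_image[OF p] perm[symmetric]
    by (intro eq_matI) (auto simp: cat_mat_def reindex_mat_def permute_list_nth[OF p])
  then show ?thesis
    by (simp add: euler_char_wrt_eq_sum_entries pseudoinverse_reindex_mat[OF p cat_mat_carrier]
        sum_entries_reindex_mat[OF p pseudoinverse_carrier[OF cat_mat_carrier]])
qed

lemma ordering_of_exists:
  assumes "finite_category C"
  shows "\<exists>as. ordering_of C as"
  using assms finite_distinct_list[of "Obj C"]
  by (auto simp: finite_category_def ordering_of_def)

lemma euler_char_eq_wrt:
  assumes "ordering_of C as"
  shows "euler_char C = euler_char_wrt C as"
  unfolding euler_char_def
  by (rule euler_char_wrt_independent[OF someI[of "ordering_of C", OF assms] assms])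

section \<open>Disjoint unions\<close>

lemma ordering_of_disjoint_union:
  assumes "ordering_of A as" and "ordering_of B bs"
  shows "ordering_of (disjoint_union A B) (map Inl as @ map Inr bs)"
  using assms by (auto simp: ordering_of_def disjoint_union_def distinct_map)

text \<open>
  The off-diagonal blocks vanish because the hom-sets between the two summands are empty.
\<close>
lemma cat_mat_disjoint_union:
  "cat_mat (disjoint_union A B) (map Inl as @ map Inr bs) = block_diag (cat_mat A as) (cat_mat B bs)"
  by (rule eq_matI) (auto simp: cat_mat_def block_diag_def nth_append card_image)

theorem theorem2p17:
  fixes A :: "('o, 'm) category" and B :: "('p, 'n) category"
  assumes "finite_category A" and "finite_category B"
  shows "euler_char (disjoint_union A B) = euler_char A + euler_char B"
proof -
  obtain as where as: "ordering_of A as"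
    using ordering_of_exists[OF assms(1)] ..
  obtain bs where bs: "ordering_of B bs"
    using ordering_of_exists[OF assms(2)] ..
  have "euler_char (disjoint_union A B)
      = sum_entries (pseudoinverse (block_diag (cat_mat A as) (cat_mat B bs)))"
    by (simp add: euler_char_eq_wrt[OF ordering_of_disjoint_union[OF as bs]]
        euler_char_wrt_eq_sum_entries cat_mat_disjoint_union)
  also have "\<dots> = euler_char A + euler_char B"
    by (simp add: pseudoinverse_block_diag sum_entries_block_diag
        euler_char_eq_wrt[OF as] euler_char_eq_wrt[OF bs] euler_char_wrt_eq_sum_entries)
  finally show ?thesis .
qed

end
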